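(* Let $\widetilde Y=B+W$, where $W$ is a symmetric $n\times n$ noise matrix with entries $(W_{ij})_{1\le i\le j\le n}$ drawn i.i.d. from $\mathcal{N}(0,\sigma^2)$. Assume $m<n/3$. Then there exist universal constants $C,C'>0$ such that, for all sufficiently large $n$, $$\inf_{\hat\eta\in[0,1]^n}\ \sup_{B\in\mathcal{B}_S(b,n,m)}\ \mathbb{E}_{B}\|\eta-\hat\eta\|_{\mathrm H}\ \ge\ \max_{m'\in(0,m]}\ 4m'\left[\frac1{16}\,f_n\!\left(\frac{Cb^4}{\sigma^4},m'\right)-e^{-\frac{(m-m')^2}{2m}}\right],$$ where for $a\in\mathbb{R}$, $$f_n(a,m')=3-\frac{m'}{n}\left(\exp\Bigl\{a-C'n\log\Bigl(\frac{n}{3m'}\Bigr)\Bigr\}+\exp\Bigl(\frac{a}{\log n}-C'n\Bigr)+\exp\Bigl\{\frac{C'a}{n}\Bigr\}\right).$$ Here the infimum is over all estimators $\hat\eta$ that are measurable functions of $\widetilde Y$ with values in $[0,1]^n$, and $\eta\in\{0,1\}^n$ is the support indicator of $B$.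
   Context: For a symmetric matrix $B\in\mathbb{R}^{n\times n}$, its node-level support $I_B\subseteq[n]$ is the smallest index set $I$ such that $\|B_{i,\cdot}\|_2>0$ for all $i\in I$ and $B_{ij}=0$ for all $i,j\in I^c$. The support indicator $\eta\in\{0,1\}^n$ of $B$ is $\eta_i=\mathbf 1\{i\in I_B\}$. Write $\tilde b_i=(B_{ij})_{j\in([n]\setminus I_B)\cup\{i\}}$. Parameter class: $$\mathcal{B}_S(b,n,m)=\bigl\{B\in\mathrm{Sym}(n):\ |I_B|\le m;\ \|\tilde b_i\|_2\ge b\text{ and }\|B_{i,\cdot}\|_0\ge m+1\ \ \forall i\in I_B;\ B_{ij}=0\ \ \forall i,j\in I_B^c\bigr\},$$ where $\mathrm{Sym}(n)$ is the set of real symmetric $n\times n$ matrices and $\|\cdot\|_0$ counts nonzero entries. Hamming distance: $\|\hat\eta-\eta\|_{\mathrm H}=\sum_{j=1}^n|\hat\eta_j-\eta_j|$. $\mathbb{E}_B$ is the expectation when the signal matrix is $B$. *)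

theory Defs
  imports "HOL-Probability.Probability"
begin

text \<open>
  An \<open>n \<times> n\<close> matrix is a point of the finite product space over the index set
  \<open>{..<n} \<times> {..<n}\<close>; rows and columns are numbered from 0.
\<close>

definition matrix_space :: "nat \<Rightarrow> (nat \<times> nat \<Rightarrow> real) measure" where
  "matrix_space n = (\<Pi>\<^sub>M p\<in>{..<n} \<times> {..<n}. borel)"

definition Sym :: "nat \<Rightarrow> (nat \<times> nat \<Rightarrow> real) set" where
  "Sym n = {B \<in> space (matrix_space n). \<forall>i<n. \<forall>j<n. B (i, j) = B (j, i)}"

definition row_l2_on :: "(nat \<times> nat \<Rightarrow> real) \<Rightarrow> nat \<Rightarrow> nat set \<Rightarrow> real" where
  "row_l2_on B i J = L2_set (\<lambda>j. B (i, j)) J"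

definition row_l0 :: "nat \<Rightarrow> (nat \<times> nat \<Rightarrow> real) \<Rightarrow> nat \<Rightarrow> nat" where
  "row_l0 n B i = card {j \<in> {..<n}. B (i, j) \<noteq> 0}"

definition covers :: "nat \<Rightarrow> (nat \<times> nat \<Rightarrow> real) \<Rightarrow> nat set \<Rightarrow> bool" where
  "covers n B I \<longleftrightarrow>
     I \<subseteq> {..<n} \<and>
     (\<forall>i\<in>I. row_l2_on B i {..<n} > 0) \<and>
     (\<forall>i\<in>{..<n} - I. \<forall>j\<in>{..<n} - I. B (i, j) = 0)"

text \<open>
  Smallest means of least cardinality. A general matrix can have several such sets, and
  then one of them is chosen; for the matrices in \<open>signal_class\<close> below there is only one,
  see \<open>node_support_eqI\<close>.
\<close>

definition node_support :: "nat \<Rightarrow> (nat \<times> nat \<Rightarrow> real) \<Rightarrow> nat set" where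
  "node_support n B = arg_min card (covers n B)"

definition support_indicator :: "nat \<Rightarrow> (nat \<times> nat \<Rightarrow> real) \<Rightarrow> nat \<Rightarrow> real" where
  "support_indicator n B = indicator (node_support n B)"

definition signal_class :: "real \<Rightarrow> nat \<Rightarrow> nat \<Rightarrow> (nat \<times> nat \<Rightarrow> real) set" where
  "signal_class b n m = {B \<in> Sym n. let I = node_support n B in
     card I \<le> m \<and>
     (\<forall>i\<in>I. row_l2_on B i (({..<n} - I) \<union> {i}) \<ge> b \<and> row_l0 n B i \<ge> m + 1) \<and>
     (\<forall>i\<in>{..<n} - I. \<forall>j\<in>{..<n} - I. B (i, j) = 0)}"

lemma node_support_eqI:
  assumes I: "covers n B I" and card_I: "card I \<le> m"
    and rows: "\<And>i. i \<in> I \<Longrightarrow> row_l0 n B i \<ge> m + 1"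
  shows "node_support n B = I"
proof -
  have sub: "I \<subseteq> J" if J: "covers n B J" and card_J: "card J \<le> m" for J
  proof
    fix i assume i: "i \<in> I"
    show "i \<in> J"
    proof (rule ccontr)
      assume "i \<notin> J"
      with i I J have "{j \<in> {..<n}. B (i, j) \<noteq> 0} \<subseteq> J"
        unfolding covers_def by blast
      moreover have "finite J"
        using J finite_subset unfolding covers_def by blast
      ultimately have "row_l0 n B i \<le> card J"
        unfolding row_l0_def by (intro card_mono)
      with rows[OF i] card_J show False by simp
    qed
  qed
  have cov: "covers n B (node_support n B)" and le: "card (node_support n B) \<le> card I"
    unfolding node_support_def
    using arg_min_nat_lemma[of "covers n B" I card, OF I] I by blast+
  have "finite (node_support n B)"
    using cov finite_subset unfolding covers_def by blast
  moreover have "I \<subseteq> node_support n B"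
    using sub[OF cov] le card_I by linarith
  ultimately show ?thesis
    using le card_seteq by blast
qed

definition noise_law :: "nat \<Rightarrow> real \<Rightarrow> (nat \<times> nat \<Rightarrow> real) measure" where
  "noise_law n \<sigma> = (\<Pi>\<^sub>M p\<in>{(i, j). i \<le> j \<and> j < n}. density lborel (normal_density 0 \<sigma>))"

definition observation :: "nat \<Rightarrow> (nat \<times> nat \<Rightarrow> real) \<Rightarrow> (nat \<times> nat \<Rightarrow> real) \<Rightarrow> (nat \<times> nat \<Rightarrow> real)" where
  "observation n B W = (\<lambda>(i, j)\<in>{..<n} \<times> {..<n}. B (i, j) + W (min i j, max i j))"

definition observation_law :: "nat \<Rightarrow> real \<Rightarrow> (nat \<times> nat \<Rightarrow> real) \<Rightarrow> (nat \<times> nat \<Rightarrow> real) measure" where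
  "observation_law n \<sigma> B = distr (noise_law n \<sigma>) (matrix_space n) (observation n B)"

definition estimators :: "nat \<Rightarrow> ((nat \<times> nat \<Rightarrow> real) \<Rightarrow> nat \<Rightarrow> real) set" where
  "estimators n = matrix_space n \<rightarrow>\<^sub>M (\<Pi>\<^sub>M j\<in>{..<n}. restrict_space borel {0..1})"

definition hamming :: "nat \<Rightarrow> (nat \<Rightarrow> real) \<Rightarrow> (nat \<Rightarrow> real) \<Rightarrow> real" where
  "hamming n x y = (\<Sum>j<n. \<bar>x j - y j\<bar>)"

text \<open>
  For an estimator and \<open>\<sigma> > 0\<close> the risk lies between 0 and \<open>n\<close>, and the zero matrix belongs to
  every \<open>signal_class\<close>. So the supremum and the infimum of risks over the signal class and
  over the estimators are those of nonempty bounded sets of reals.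
\<close>

definition risk :: "nat \<Rightarrow> real \<Rightarrow> (nat \<times> nat \<Rightarrow> real) \<Rightarrow> ((nat \<times> nat \<Rightarrow> real) \<Rightarrow> nat \<Rightarrow> real) \<Rightarrow> real" where
  "risk n \<sigma> B h = (\<integral>Y. hamming n (support_indicator n B) (h Y) \<partial>observation_law n \<sigma> B)"

definition f_bound :: "real \<Rightarrow> nat \<Rightarrow> real \<Rightarrow> real \<Rightarrow> real" where
  "f_bound C' n a m' = 3 - m' / real n *
     (exp (a - C' * real n * ln (real n / (3 * m'))) +
      exp (a / ln (real n) - C' * real n) +
      exp (C' * a / real n))"

end

theory Submission
  imports Defs
begin

text \<open>
  Put the following prior on the signal: the support \<open>I\<close> contains each node independently with
  probability \<open>p = m' / n\<close>, and the entry \<open>(i, j)\<close> is \<open>t\<close> times a symmetric matrix of random signs if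
  \<open>i \<in> I\<close> or \<open>j \<in> I\<close>, and 0 otherwise, where \<open>t\<^sup>2 = (3 b\<^sup>2 / 2 + \<sigma>\<^sup>2) / n\<close>; the \<open>\<sigma>\<^sup>2\<close> makes the signal
  rows nonzero also for \<open>b = 0\<close>. Averaging over the signs gives, relative to pure noise, a density that is a
  product over the entries touching \<open>I\<close>.
  For \<open>i \<notin> S\<close> the supports \<open>S\<close> and \<open>S \<union> {i}\<close> therefore differ only in at most \<open>n\<close> independent entries,
  and the second moment of their likelihood ratio is at most
  \<open>cosh (t\<^sup>2 / \<sigma>\<^sup>2) ^ n \<le> exp (n t\<^sup>4 / (2 \<sigma>\<^sup>4))\<close>, which bounds from below the risk of deciding whether \<open>i\<close>
  belongs to the support.

  Pairing \<open>S\<close> with \<open>S \<union> {i}\<close> only for \<open>|S| < m\<close> keeps both matrices in the class, so the prior need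
  not be conditioned: the truncation costs the probability that \<open>|S| \<ge> m\<close>, a Chernoff bound.
  Of the three exponentials in \<open>f_bound\<close> only the last one is needed; the other two only weaken the bound.
\<close>

subsection \<open>Gaussian likelihood ratios\<close>

definition gauss :: "real \<Rightarrow> real measure" where
  "gauss \<sigma> = density lborel (normal_density 0 \<sigma>)"

text \<open>For \<open>\<sigma> > 0\<close>, the density of the normal law with mean
  \<open>\<mu>\<close> relative to the centred one of the same variance.\<close>

definition gauss_lr :: "real \<Rightarrow> real \<Rightarrow> real \<Rightarrow> real" where
  "gauss_lr \<sigma> \<mu> w = exp ((\<mu> * w - \<mu>\<^sup>2 / 2) / \<sigma>\<^sup>2)"

lemma sets_gauss [measurable_cong, simp]: "sets (gauss \<sigma>) = sets borel"
  by (simp add: gauss_def)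

lemma space_gauss [simp]: "space (gauss \<sigma>) = UNIV"
  by (simp add: gauss_def)

lemma prob_space_gauss: "0 < \<sigma> \<Longrightarrow> prob_space (gauss \<sigma>)"
  unfolding gauss_def by (rule prob_space_normal_density)

lemma gauss_lr_nonneg [simp]: "0 \<le> gauss_lr \<sigma> \<mu> w"
  by (simp add: gauss_lr_def)

lemma measurable_gauss_lr [measurable]: "gauss_lr \<sigma> \<mu> \<in> borel_measurable borel"
  unfolding gauss_lr_def by measurable

lemma gauss_lr_0 [simp]: "gauss_lr \<sigma> 0 w = 1"
  by (simp add: gauss_lr_def)

lemma normal_density_mult_gauss_lr:
  assumes "0 < \<sigma>"
  shows "normal_density 0 \<sigma> w * gauss_lr \<sigma> \<mu> w = normal_density \<mu> \<sigma> w"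
  using assms unfolding normal_density_def gauss_lr_def
  by (simp add: mult_exp_exp power2_eq_square field_simps)

text \<open>Completing the square: the exponents are linear in \<open>w\<close>, so the product is
  again a likelihood ratio, at the summed mean, up to a constant. Second moments thereby reduce to
  \<open>has_bochner_integral_gauss_lr\<close>.\<close>

lemma gauss_lr_mult:
  assumes "0 < \<sigma>"
  shows "gauss_lr \<sigma> \<mu> w * gauss_lr \<sigma> \<nu> w = exp (\<mu> * \<nu> / \<sigma>\<^sup>2) * gauss_lr \<sigma> (\<mu> + \<nu>) w"
  using assms unfolding gauss_lr_def by (simp add: mult_exp_exp power2_eq_square field_simps)

lemma has_bochner_integral_gauss_lr:
  assumes "0 < \<sigma>"
  shows "has_bochner_integral (gauss \<sigma>) (gauss_lr \<sigma> \<mu>) 1"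
  using assms unfolding gauss_def
  by (intro has_bochner_integral_density)
     (simp_all add: normal_density_mult_gauss_lr has_bochner_integral_iff)

lemma emeasure_gauss_vimage_shift:
  assumes "0 < \<sigma>" "A \<in> sets borel"
  shows "emeasure (gauss \<sigma>) ((\<lambda>w. w + \<mu>) -` A) = emeasure (density lborel (normal_density \<mu> \<sigma>)) A"
proof -
  have [measurable]: "(\<lambda>w. w + \<mu>) -` A \<in> sets borel"
    using assms(2) measurable_sets[of "\<lambda>w. w + \<mu>" borel borel A] by simp
  have "emeasure (density lborel (normal_density \<mu> \<sigma>)) A
      = (\<integral>\<^sup>+w. ennreal (normal_density \<mu> \<sigma> w) * indicator A w \<partial>lborel)"
    using assms by (simp add: emeasure_density)
  also have "\<dots> = (\<integral>\<^sup>+w. ennreal (normal_density \<mu> \<sigma> (\<mu> + 1 * w)) * indicator A (\<mu> + 1 * w) \<partial>lborel)"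
    using assms by (subst nn_integral_real_affine[where c=1 and t=\<mu>]) auto
  also have "\<dots> = (\<integral>\<^sup>+w. ennreal (normal_density 0 \<sigma> w) * indicator ((\<lambda>w. w + \<mu>) -` A) w \<partial>lborel)"
    by (intro nn_integral_cong) (auto simp: normal_density_def indicator_def add.commute)
  also have "\<dots> = emeasure (gauss \<sigma>) ((\<lambda>w. w + \<mu>) -` A)"
    unfolding gauss_def by (subst emeasure_density) (auto simp: measurable_lborel1)
  finally show ?thesis ..
qed

lemma nn_integral_gauss_lr_indicator:
  assumes "0 < \<sigma>" "A \<in> sets borel"
  shows "(\<integral>\<^sup>+w. ennreal (gauss_lr \<sigma> \<mu> w) * indicator A w \<partial>gauss \<sigma>)
    = emeasure (density lborel (normal_density \<mu> \<sigma>)) A"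
  using assms unfolding gauss_def
  by (simp add: emeasure_density nn_integral_density mult.assoc [symmetric]
      ennreal_mult [symmetric] normal_density_mult_gauss_lr)

text \<open>The Cameron-Martin formula in finite dimension. Both measures give every box its mass
  under the product of the shifted normal laws, and that product is determined by its values on
  boxes.\<close>

lemma distr_PiM_gauss_shift:
  fixes \<mu> :: "'i \<Rightarrow> real"
  assumes \<sigma>: "0 < \<sigma>" and T: "finite T"
  defines "N \<equiv> \<Pi>\<^sub>M q\<in>T. gauss \<sigma>"
  shows "distr N N (\<lambda>w. \<lambda>q\<in>T. w q + \<mu> q) = density N (\<lambda>w. \<Prod>q\<in>T. gauss_lr \<sigma> (\<mu> q) (w q))"
proof -
  let ?K = "\<lambda>q. density lborel (normal_density (\<mu> q) \<sigma>)"
  interpret G: prob_space "gauss \<sigma>" by (rule prob_space_gauss[OF \<sigma>])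
  interpret PG: product_sigma_finite "\<lambda>_::'i. gauss \<sigma>" ..
  interpret FG: finite_product_prob_space "\<lambda>_::'i. gauss \<sigma>" T by standard (rule T)
  interpret PK: product_prob_space ?K
    by (rule product_prob_spaceI) (rule prob_space_normal_density[OF \<sigma>])
  have sets_N: "sets N = sets (PiM T ?K)"
    unfolding N_def by (intro sets_PiM_cong) auto
  have 1: "distr N N (\<lambda>w. \<lambda>q\<in>T. w q + \<mu> q) = PiM T ?K"
  proof (rule PK.PiM_eqI[OF T])
    fix A assume "\<And>q. q \<in> T \<Longrightarrow> A q \<in> sets (?K q)"
    then have A: "\<And>q. q \<in> T \<Longrightarrow> A q \<in> sets borel" by simp
    have A': "(\<lambda>w. w + \<mu> q) -` A q \<in> sets borel" if "q \<in> T" for q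
      using A[OF that] measurable_sets[of "\<lambda>w. w + \<mu> q" borel borel "A q"] by simp
    have [measurable]: "(\<lambda>w. \<lambda>q\<in>T. w q + \<mu> q) \<in> N \<rightarrow>\<^sub>M N"
      unfolding N_def by measurable
    have "Pi\<^sub>E T A \<in> sets N"
      unfolding N_def using T A by (intro sets_PiM_I_finite) auto
    then have "emeasure (distr N N (\<lambda>w. \<lambda>q\<in>T. w q + \<mu> q)) (Pi\<^sub>E T A)
        = emeasure N ((\<lambda>w. \<lambda>q\<in>T. w q + \<mu> q) -` Pi\<^sub>E T A \<inter> space N)"
      by (intro emeasure_distr) auto
    also have "(\<lambda>w. \<lambda>q\<in>T. w q + \<mu> q) -` Pi\<^sub>E T A \<inter> space N = Pi\<^sub>E T (\<lambda>q. (\<lambda>w. w + \<mu> q) -` A q)"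
      unfolding N_def by (auto simp: space_PiM PiE_def Pi_def)
    also have "emeasure N \<dots> = (\<Prod>q\<in>T. emeasure (gauss \<sigma>) ((\<lambda>w. w + \<mu> q) -` A q))"
      unfolding N_def using A' by (intro FG.measure_times) auto
    also have "\<dots> = (\<Prod>q\<in>T. emeasure (?K q) (A q))"
      using A by (intro prod.cong) (simp_all add: emeasure_gauss_vimage_shift[OF \<sigma>])
    finally show "emeasure (distr N N (\<lambda>w. \<lambda>q\<in>T. w q + \<mu> q)) (Pi\<^sub>E T A) = (\<Prod>q\<in>T. emeasure (?K q) (A q))" .
  qed (simp add: sets_N)
  have 2: "density N (\<lambda>w. \<Prod>q\<in>T. gauss_lr \<sigma> (\<mu> q) (w q)) = PiM T ?K"
  proof (rule PK.PiM_eqI[OF T])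
    fix A assume "\<And>q. q \<in> T \<Longrightarrow> A q \<in> sets (?K q)"
    then have A [measurable]: "\<And>q. q \<in> T \<Longrightarrow> A q \<in> sets borel" by simp
    have box: "Pi\<^sub>E T A \<in> sets N"
      unfolding N_def using T A by (intro sets_PiM_I_finite) auto
    have "emeasure (density N (\<lambda>w. \<Prod>q\<in>T. gauss_lr \<sigma> (\<mu> q) (w q))) (Pi\<^sub>E T A)
        = (\<integral>\<^sup>+w. ennreal (\<Prod>q\<in>T. gauss_lr \<sigma> (\<mu> q) (w q)) * indicator (Pi\<^sub>E T A) w \<partial>N)"
      using box by (intro emeasure_density) (auto simp: N_def)
    also have "\<dots> = (\<integral>\<^sup>+w. (\<Prod>q\<in>T. ennreal (gauss_lr \<sigma> (\<mu> q) (w q)) * indicator (A q) (w q)) \<partial>N)"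
    proof (intro nn_integral_cong)
      fix w assume "w \<in> space N"
      \<comment> \<open>Membership in the box \<open>Pi\<^sub>E T A\<close> also demands
        extensionality. It holds on the space of \<open>N\<close>, and there the indicator factors
        over the coordinates.\<close>
      then have "w \<in> extensional T" by (auto simp: N_def space_PiM PiE_iff)
      then have "indicator (Pi\<^sub>E T A) w = (\<Prod>q\<in>T. indicator (A q) (w q) :: ennreal)"
        using T by (auto simp: indicator_def PiE_iff prod_zero_iff intro!: prod_zero)
      then show "ennreal (\<Prod>q\<in>T. gauss_lr \<sigma> (\<mu> q) (w q)) * indicator (Pi\<^sub>E T A) w
        = (\<Prod>q\<in>T. ennreal (gauss_lr \<sigma> (\<mu> q) (w q)) * indicator (A q) (w q))"
        by (simp add: prod.distrib prod_ennreal)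
    qed
    also have "\<dots> = (\<Prod>q\<in>T. \<integral>\<^sup>+v. ennreal (gauss_lr \<sigma> (\<mu> q) v) * indicator (A q) v \<partial>gauss \<sigma>)"
      unfolding N_def using T by (intro PG.product_nn_integral_prod) auto
    also have "\<dots> = (\<Prod>q\<in>T. emeasure (?K q) (A q))"
      using A by (intro prod.cong) (simp_all add: nn_integral_gauss_lr_indicator[OF \<sigma>])
    finally show "emeasure (density N (\<lambda>w. \<Prod>q\<in>T. gauss_lr \<sigma> (\<mu> q) (w q))) (Pi\<^sub>E T A)
      = (\<Prod>q\<in>T. emeasure (?K q) (A q))" .
  qed (simp add: sets_N)
  show ?thesis using 1 2 by simp
qed

text \<open>Moves the shift from the argument of \<open>g\<close> into a weight, so that all signals
  are integrated against the same pure noise and averaging over signals means averaging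
  weights.\<close>

lemma integral_PiM_gauss_shift:
  fixes \<mu> :: "'i \<Rightarrow> real" and g :: "('i \<Rightarrow> real) \<Rightarrow> real"
  assumes \<sigma>: "0 < \<sigma>" and T: "finite T"
  defines "N \<equiv> \<Pi>\<^sub>M q\<in>T. gauss \<sigma>"
  assumes g: "g \<in> borel_measurable N"
  shows "(\<integral>w. g (\<lambda>q\<in>T. w q + \<mu> q) \<partial>N) = (\<integral>w. (\<Prod>q\<in>T. gauss_lr \<sigma> (\<mu> q) (w q)) * g w \<partial>N)"
proof -
  have "(\<integral>w. g (\<lambda>q\<in>T. w q + \<mu> q) \<partial>N) = integral\<^sup>L (distr N N (\<lambda>w. \<lambda>q\<in>T. w q + \<mu> q)) g"
    using g by (subst integral_distr) (auto simp: N_def)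
  also have "\<dots> = (\<integral>w. g w \<partial>density N (\<lambda>w. \<Prod>q\<in>T. gauss_lr \<sigma> (\<mu> q) (w q)))"
    unfolding N_def by (simp add: distr_PiM_gauss_shift[OF \<sigma> T])
  also have "\<dots> = (\<integral>w. (\<Prod>q\<in>T. gauss_lr \<sigma> (\<mu> q) (w q)) *\<^sub>R g w \<partial>N)"
    using g by (intro integral_density) (auto simp: N_def intro!: prod_nonneg)
  finally show ?thesis by simp
qed

text \<open>The likelihood ratio, against pure noise, of a normal variable whose mean is
  \<open>t\<close> or \<open>- t\<close> with probability 1/2 each.\<close>

definition sign_lr :: "real \<Rightarrow> real \<Rightarrow> real \<Rightarrow> real" where
  "sign_lr \<sigma> t w = (gauss_lr \<sigma> t w + gauss_lr \<sigma> (- t) w) / 2"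

lemma sign_lr_nonneg [simp]: "0 \<le> sign_lr \<sigma> t w"
  by (simp add: sign_lr_def)

lemma measurable_sign_lr [measurable]: "sign_lr \<sigma> t \<in> borel_measurable borel"
  unfolding sign_lr_def by measurable

lemma has_bochner_integral_sign_lr:
  assumes "0 < \<sigma>"
  shows "has_bochner_integral (gauss \<sigma>) (sign_lr \<sigma> t) 1"
proof -
  have "has_bochner_integral (gauss \<sigma>) (\<lambda>w. (gauss_lr \<sigma> t w + gauss_lr \<sigma> (- t) w) / 2) ((1 + 1) / 2)"
    by (intro has_bochner_integral_divide_zero has_bochner_integral_add
        has_bochner_integral_gauss_lr assms)
  then show ?thesis unfolding sign_lr_def by simp
qed

text \<open>Hoeffding's lemma for a fair sign: at probability 1/2 and interval length
  \<open>2 * x\<close>, the left side of \<open>Hoeffdings_lemma_aux\<close> is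
  \<open>ln (cosh x)\<close>.\<close>

lemma cosh_le_exp_half_square:
  fixes x :: real
  assumes "0 \<le> x"
  shows "cosh x \<le> exp (x\<^sup>2 / 2)"
proof -
  have pos: "0 < 1 + (exp (2 * x) - 1) / 2"
    using exp_gt_zero[of "2 * x"] by (simp add: field_simps del: exp_gt_zero)
  have "- x + ln (1 + (exp (2 * x) - 1) / 2) \<le> x\<^sup>2 / 2"
    using Hoeffdings_lemma_aux[of "2 * x" "1/2"] assms by (simp add: power2_eq_square)
  then have "exp (- x + ln (1 + (exp (2 * x) - 1) / 2)) \<le> exp (x\<^sup>2 / 2)"
    by simp
  also have "exp (- x + ln (1 + (exp (2 * x) - 1) / 2)) = exp (- x) * (1 + (exp (2 * x) - 1) / 2)"
    using pos by (simp only: exp_add exp_ln)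
  also have "\<dots> = cosh x"
    by (simp add: cosh_field_def field_simps mult_exp_exp)
  finally show ?thesis .
qed

text \<open>Of the four products in the square, by \<open>gauss_lr_mult\<close> the two with equal
  signs have mean \<open>exp (t\<^sup>2 / \<sigma>\<^sup>2)\<close> and the two with opposite signs
  are constantly \<open>exp (- (t\<^sup>2 / \<sigma>\<^sup>2))\<close>.\<close>

lemma has_bochner_integral_sign_lr_square:
  assumes "0 < \<sigma>"
  shows "has_bochner_integral (gauss \<sigma>) (\<lambda>w. (sign_lr \<sigma> t w)\<^sup>2) (cosh (t\<^sup>2 / \<sigma>\<^sup>2))"
proof -
  let ?e = "exp (t\<^sup>2 / \<sigma>\<^sup>2)" and ?f = "exp (- (t\<^sup>2 / \<sigma>\<^sup>2))"
  have eq: "(sign_lr \<sigma> t w)\<^sup>2 =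
      (?e * gauss_lr \<sigma> (2 * t) w + ?e * gauss_lr \<sigma> (- (2 * t)) w + 2 * ?f) / 4" for w
    using gauss_lr_mult[OF assms, of t w t] gauss_lr_mult[OF assms, of "- t" w "- t"]
      gauss_lr_mult[OF assms, of t w "- t"]
    by (simp add: sign_lr_def power2_eq_square field_simps)
  have "has_bochner_integral (gauss \<sigma>) (\<lambda>w. ?f) ?f"
    using prob_space.prob_space[OF prob_space_gauss[OF assms]]
      finite_measure.integrable_const[OF prob_space.finite_measure[OF prob_space_gauss[OF assms]]]
    by (simp add: has_bochner_integral_iff)
  then have "has_bochner_integral (gauss \<sigma>)
      (\<lambda>w. (?e * gauss_lr \<sigma> (2 * t) w + ?e * gauss_lr \<sigma> (- (2 * t)) w + 2 * ?f) / 4)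
      ((?e * 1 + ?e * 1 + 2 * ?f) / 4)"
    by (intro has_bochner_integral_divide_zero has_bochner_integral_add
        has_bochner_integral_mult_right has_bochner_integral_gauss_lr assms)
  moreover have "(?e * 1 + ?e * 1 + 2 * ?f) / 4 = cosh (t\<^sup>2 / \<sigma>\<^sup>2)"
    by (simp add: cosh_field_def field_simps)
  ultimately show ?thesis unfolding eq by simp
qed

subsection \<open>Bernoulli random subsets\<close>

definition bernoulli_weight :: "real \<Rightarrow> 'a set \<Rightarrow> 'a set \<Rightarrow> real" where
  "bernoulli_weight p A S = p ^ card S * (1 - p) ^ card (A - S)"

lemma bernoulli_weight_nonneg: "0 \<le> p \<Longrightarrow> p \<le> 1 \<Longrightarrow> 0 \<le> bernoulli_weight p A S"
  by (simp add: bernoulli_weight_def)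

text \<open>Membership of \<open>i\<close> is independent of the rest, so its factor splits off.
  This permits conditioning on the support outside \<open>i\<close>.\<close>

lemma bernoulli_weight_insert:
  assumes "finite A" "i \<in> A" "S \<subseteq> A - {i}"
  shows "bernoulli_weight p A (insert i S) = p * bernoulli_weight p (A - {i}) S"
    and "bernoulli_weight p A S = (1 - p) * bernoulli_weight p (A - {i}) S"
proof -
  have S: "finite S" "i \<notin> S" using assms finite_subset by auto
  have "A - insert i S = A - {i} - S" "A - S = insert i (A - {i} - S)" using assms by auto
  then show "bernoulli_weight p A (insert i S) = p * bernoulli_weight p (A - {i}) S"
    and "bernoulli_weight p A S = (1 - p) * bernoulli_weight p (A - {i}) S"
    using S assms(1) by (simp_all add: bernoulli_weight_def)
qed

text \<open>The generating function of the binomial size of a random subset, by expanding the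
  product over \<open>A\<close>. At \<open>x = 1\<close> it gives total mass 1; for
  \<open>x > 1\<close> it drives the Chernoff bound.\<close>

lemma sum_bernoulli_weight_power:
  assumes "finite A"
  shows "(\<Sum>S\<in>Pow A. bernoulli_weight p A S * x ^ card S) = (p * x + (1 - p)) ^ card A"
proof -
  have "(\<Prod>a\<in>A. p * x + (1 - p)) = (\<Sum>S\<in>Pow A. (\<Prod>a\<in>S. p * x) * (\<Prod>a\<in>A - S. 1 - p))"
    by (rule prod_add[OF assms])
  then show ?thesis
    by (simp add: bernoulli_weight_def power_mult_distrib algebra_simps)
qed

text \<open>The difference of the two sides vanishes at 1 and has derivative
  \<open>- ((1 - y)\<^sup>2 / y)\<close>. With \<open>x = m' / m\<close> it turns the Chernoff
  exponent into a quadratic one.\<close>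

lemma ln_ge_quadratic:
  fixes x :: real
  assumes "0 < x" "x \<le> 1"
  shows "(1 - x)\<^sup>2 / 2 \<le> x - 1 - ln x"
proof -
  have "(\<lambda>x::real. x - 1 - ln x - (1 - x)\<^sup>2 / 2) 1 \<le> (\<lambda>x. x - 1 - ln x - (1 - x)\<^sup>2 / 2) x"
  proof (rule DERIV_nonpos_imp_nonincreasing[OF assms(2)])
    fix y :: real assume y: "x \<le> y" "y \<le> 1"
    have "((\<lambda>x. x - 1 - ln x - (1 - x)\<^sup>2 / 2) has_real_derivative 1 - 1 / y + (1 - y)) (at y)"
      using y assms(1) by (auto intro!: derivative_eq_intros simp: field_simps)
    moreover have "1 - 1 / y + (1 - y) = - ((1 - y)\<^sup>2 / y)"
      using y assms(1) by (simp add: field_simps power2_eq_square)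
    ultimately show "\<exists>d. ((\<lambda>x. x - 1 - ln x - (1 - x)\<^sup>2 / 2) has_real_derivative d) (at y) \<and> d \<le> 0"
      using y assms(1) by (intro exI[of _ "1 - 1 / y + (1 - y)"]) auto
  qed
  then show ?thesis by simp
qed

text \<open>Chernoff's method: on the tail \<open>x ^ m\<close> is at most
  \<open>x ^ card S\<close>, whose mean is the generating function. Since
  \<open>card A \<le> n\<close>, the expected size is at most \<open>m'\<close>.\<close>

lemma bernoulli_tail:
  fixes m' :: real
  assumes A: "finite A" "card A \<le> n" and m': "0 < m'" "m' \<le> real m" "m' < real n"
  shows "(\<Sum>S\<in>{S\<in>Pow A. m \<le> card S}. bernoulli_weight (m' / n) A S)
    \<le> exp (- ((real m - m')\<^sup>2 / (2 * real m)))"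
proof -
  define p where "p = m' / real n"
  \<comment> \<open>This tilt minimises the bound \<open>exp (m' * (x - 1)) / x ^ m\<close>; it is
    at least 1 because \<open>m' \<le> m\<close>.\<close>
  define x where "x = real m / m'"
  have n: "0 < real n" and m: "0 < real m" using m' by auto
  have p: "0 < p" "p \<le> 1" "p * n = m'" using m' n by (auto simp: p_def)
  have x: "1 \<le> x" "0 < x" using m' by (auto simp: x_def)
  have "(\<Sum>S\<in>{S\<in>Pow A. m \<le> card S}. bernoulli_weight p A S) * x ^ m
      \<le> (\<Sum>S\<in>{S\<in>Pow A. m \<le> card S}. bernoulli_weight p A S * x ^ card S)"
    unfolding sum_distrib_right using p x
    by (intro sum_mono mult_left_mono power_increasing bernoulli_weight_nonneg) auto
  also have "\<dots> \<le> (\<Sum>S\<in>Pow A. bernoulli_weight p A S * x ^ card S)"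
    using p x A by (intro sum_mono2) (auto intro!: mult_nonneg_nonneg bernoulli_weight_nonneg)
  also have "\<dots> = (1 + p * (x - 1)) ^ card A"
    using sum_bernoulli_weight_power[OF A(1), of p x] by (simp add: algebra_simps)
  also have "\<dots> \<le> exp (p * (x - 1)) ^ card A"
    using p x by (intro power_mono exp_ge_add_one_self) auto
  also have "\<dots> = exp (card A * (p * (x - 1)))"
    by (simp add: exp_of_nat_mult)
  also have "\<dots> \<le> exp (n * (p * (x - 1)))"
    using p x A by (intro iffD2[OF exp_le_cancel_iff] mult_right_mono) auto
  also have "n * (p * (x - 1)) = real m - m'"
    using p(3) m' by (simp add: x_def field_simps)
  finally have "(\<Sum>S\<in>{S\<in>Pow A. m \<le> card S}. bernoulli_weight p A S) \<le> exp (real m - m') / x ^ m"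
    using x by (simp add: field_simps)
  also have "x ^ m = exp (- (m * ln (m' / m)))"
    using x m' m by (simp add: exp_minus exp_of_nat_mult x_def power_divide field_simps)
  also have "exp (real m - m') / exp (- (m * ln (m' / m))) = exp (- (m * (m' / m - 1 - ln (m' / m))))"
    using m by (simp add: exp_diff [symmetric] algebra_simps)
  also have "\<dots> \<le> exp (- (m * ((1 - m' / m)\<^sup>2 / 2)))"
    using ln_ge_quadratic[of "m' / m"] m m' by (simp add: mult_left_mono)
  also have "m * ((1 - m' / m)\<^sup>2 / 2) = (real m - m')\<^sup>2 / (2 * real m)"
    using m by (simp add: power2_eq_square field_simps)
  finally show ?thesis unfolding p_def .
qed

text \<open>For fixed \<open>i\<close>, the sets \<open>S\<close> and \<open>insert i S\<close> with
  \<open>card S < m\<close> are pairwise distinct and have at most \<open>m\<close> elements, so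
  they make up part of the right-hand sum. What is left out, the sets of size \<open>m\<close>
  avoiding \<open>i\<close>, contributes nonnegatively.\<close>

lemma bernoulli_average_pairs:
  fixes r :: "'a set \<Rightarrow> 'a \<Rightarrow> real"
  assumes N: "finite N" and p: "0 \<le> p" "p \<le> 1"
    and r: "\<And>I i. I \<subseteq> N \<Longrightarrow> i \<in> N \<Longrightarrow> 0 \<le> r I i"
  shows "(\<Sum>i\<in>N. \<Sum>S\<in>{S\<in>Pow (N - {i}). card S < m}.
            bernoulli_weight p (N - {i}) S * (p * r (insert i S) i + (1 - p) * r S i))
    \<le> (\<Sum>I\<in>{I\<in>Pow N. card I \<le> m}. bernoulli_weight p N I * (\<Sum>i\<in>N. r I i))"
proof -
  have "(\<Sum>S\<in>{S\<in>Pow (N - {i}). card S < m}.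
            bernoulli_weight p (N - {i}) S * (p * r (insert i S) i + (1 - p) * r S i))
      \<le> (\<Sum>I\<in>{I\<in>Pow N. card I \<le> m}. bernoulli_weight p N I * r I i)" (is "?L \<le> ?R")
    if i: "i \<in> N" for i
  proof -
    let ?F = "{S\<in>Pow (N - {i}). card S < m}"
    have inj: "inj_on (insert i) ?F"
      by (rule inj_onI) (auto dest: insert_ident[THEN iffD1, rotated 2])
    have fin: "finite ?F" using N by simp
    have cI: "card (insert i S) \<le> m" if "S \<in> ?F" for S
      using card_insert_le_m1[of m S i] that by (cases m) auto
    have "?L = (\<Sum>S\<in>?F. bernoulli_weight p N (insert i S) * r (insert i S) i)
        + (\<Sum>S\<in>?F. bernoulli_weight p N S * r S i)"
      unfolding sum.distrib[symmetric]
      by (intro sum.cong) (auto simp: bernoulli_weight_insert[OF N i] algebra_simps)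
    also have "\<dots> = (\<Sum>I\<in>insert i ` ?F. bernoulli_weight p N I * r I i)
        + (\<Sum>S\<in>?F. bernoulli_weight p N S * r S i)"
      by (simp only: sum.reindex[OF inj] o_def)
    also have "\<dots> = (\<Sum>I\<in>insert i ` ?F \<union> ?F. bernoulli_weight p N I * r I i)"
      using fin by (intro sum.union_disjoint[symmetric]) auto
    also have "\<dots> \<le> ?R"
      using N i cI by (intro sum_mono2) (auto intro!: mult_nonneg_nonneg bernoulli_weight_nonneg p r)
    finally show ?thesis .
  qed
  then have "(\<Sum>i\<in>N. \<Sum>S\<in>{S\<in>Pow (N - {i}). card S < m}.
            bernoulli_weight p (N - {i}) S * (p * r (insert i S) i + (1 - p) * r S i))
      \<le> (\<Sum>i\<in>N. \<Sum>I\<in>{I\<in>Pow N. card I \<le> m}. bernoulli_weight p N I * r I i)"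
    by (rule sum_mono)
  also have "\<dots> = (\<Sum>I\<in>{I\<in>Pow N. card I \<le> m}. bernoulli_weight p N I * (\<Sum>i\<in>N. r I i))"
    by (subst sum.swap) (simp add: sum_distrib_left)
  finally show ?thesis .
qed

subsection \<open>Two-point Bayes risk\<close>

text \<open>Here \<open>D\<close> and \<open>D * Z\<close> are the densities of null and
  alternative, with prior weights \<open>1 - p\<close> and \<open>p\<close>, and \<open>X\<close>
  bounds the second moment of the likelihood ratio \<open>Z\<close> under the null. The loss is
  bounded below pointwise by an expression in \<open>Z\<close> and \<open>Z\<^sup>2\<close> free of
  \<open>h\<close>, which is then integrated.\<close>

lemma two_point_bayes_risk:
  fixes D Z h :: "'a \<Rightarrow> real"
  assumes p: "0 \<le> p" "p < 1"
    and D: "integrable M D" "integrable M (\<lambda>w. D w * Z w)" "integrable M (\<lambda>w. D w * (Z w)\<^sup>2)"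
    and nonneg: "\<And>w. 0 \<le> D w"
    and mass: "(\<integral>w. D w * Z w \<partial>M) = 1" and chi: "(\<integral>w. D w * (Z w)\<^sup>2 \<partial>M) \<le> X"
    and h [measurable]: "h \<in> borel_measurable M" and h01: "\<And>w. w \<in> space M \<Longrightarrow> h w \<in> {0..1}"
  shows "p - p\<^sup>2 / (4 * (1 - p)) * X
    \<le> p * (\<integral>w. (D w * Z w) * \<bar>1 - h w\<bar> \<partial>M) + (1 - p) * (\<integral>w. D w * \<bar>0 - h w\<bar> \<partial>M)"
proof -
  have mult_int: "integrable M (\<lambda>w. f w * g w)"
    if f: "integrable M f" and g: "g \<in> borel_measurable M" "\<And>w. w \<in> space M \<Longrightarrow> \<bar>g w\<bar> \<le> 1"
    for f g :: "'a \<Rightarrow> real"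
  proof (rule Bochner_Integration.integrable_bound[OF f])
    show "(\<lambda>w. f w * g w) \<in> borel_measurable M" using f g by measurable
    show "AE w in M. norm (f w * g w) \<le> norm (f w)"
      using g(2) by (intro AE_I2) (auto simp: abs_mult intro: mult_left_le)
  qed
  have i1: "integrable M (\<lambda>w. (D w * Z w) * \<bar>1 - h w\<bar>)"
    using h01 by (intro mult_int D) (auto simp: abs_le_iff)
  have i2: "integrable M (\<lambda>w. D w * \<bar>0 - h w\<bar>)"
    using h01 by (intro mult_int D) (auto simp: abs_le_iff)
  let ?k = "p\<^sup>2 / (4 * (1 - p))"
  have "p - ?k * X \<le> p * (\<integral>w. D w * Z w \<partial>M) - ?k * (\<integral>w. D w * (Z w)\<^sup>2 \<partial>M)"
    unfolding mass using mult_left_mono[OF chi, of ?k] p by simp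
  also have "\<dots> = (\<integral>w. p * (D w * Z w) - ?k * (D w * (Z w)\<^sup>2) \<partial>M)"
    using D by (subst Bochner_Integration.integral_diff) auto
  also have "\<dots> \<le> (\<integral>w. p * ((D w * Z w) * \<bar>1 - h w\<bar>) + (1 - p) * (D w * \<bar>0 - h w\<bar>) \<partial>M)"
  proof (rule integral_mono)
    fix w assume w: "w \<in> space M"
    have h: "0 \<le> h w" "h w \<le> 1" using h01[OF w] by auto
    let ?z = "Z w" and ?h = "h w"
    \<comment> \<open>The weighted loss is \<open>p * ?z - ?h * (p * ?z - (1 - p))\<close>, so the
      subtracted term must be bounded. The constant \<open>?k\<close> is chosen to make
      \<open>?k * ?z\<^sup>2 - (p * ?z - (1 - p))\<close> a perfect square; as \<open>?h\<close>
      lies between 0 and 1, the bound survives multiplication by it.\<close>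
    have am_gm: "?h * (p * ?z - (1 - p)) \<le> ?k * ?z\<^sup>2"
    proof -
      have "p * ?z - (1 - p) \<le> ?k * ?z\<^sup>2"
      proof -
        have "0 \<le> (p * ?z - 2 * (1 - p))\<^sup>2 / (4 * (1 - p))" using p by simp
        also have "\<dots> = ?k * ?z\<^sup>2 - (p * ?z - (1 - p))"
          using p by (simp add: field_simps power2_eq_square)
        finally show ?thesis by simp
      qed
      moreover have "0 \<le> ?k * ?z\<^sup>2" using p by simp
      ultimately show ?thesis
        using h by (smt (verit) mult_left_le_one_le mult_nonneg_nonpos)
    qed
    have "p * (D w * ?z) - ?k * (D w * ?z\<^sup>2) = D w * (p * ?z - ?k * ?z\<^sup>2)"
      by (simp add: algebra_simps)
    also have "\<dots> \<le> D w * (p * ?z * (1 - ?h) + (1 - p) * ?h)"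
      using am_gm nonneg[of w] by (intro mult_left_mono) (auto simp: algebra_simps)
    also have "\<dots> = p * ((D w * ?z) * \<bar>1 - ?h\<bar>) + (1 - p) * (D w * \<bar>0 - ?h\<bar>)"
      using h by (simp add: algebra_simps)
    finally show "p * (D w * ?z) - ?k * (D w * ?z\<^sup>2)
      \<le> p * ((D w * ?z) * \<bar>1 - ?h\<bar>) + (1 - p) * (D w * \<bar>0 - ?h\<bar>)" .
  qed (use D i1 i2 in auto)
  also have "\<dots> = p * (\<integral>w. (D w * Z w) * \<bar>1 - h w\<bar> \<partial>M) + (1 - p) * (\<integral>w. D w * \<bar>0 - h w\<bar> \<partial>M)"
    using i1 i2 by simp
  finally show ?thesis .
qed

subsection \<open>Random sign signals\<close>

definition upper :: "nat \<Rightarrow> (nat \<times> nat) set" where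
  "upper n = {(i, j). i \<le> j \<and> j < n}"

definition touches :: "nat set \<Rightarrow> nat \<times> nat \<Rightarrow> bool" where
  "touches I q \<longleftrightarrow> fst q \<in> I \<or> snd q \<in> I"

definition signs :: "nat \<Rightarrow> (nat \<times> nat \<Rightarrow> real) set" where
  "signs n = (\<Pi>\<^sub>E q\<in>upper n. {- 1, 1})"

definition sign_signal :: "nat \<Rightarrow> real \<Rightarrow> nat set \<Rightarrow> (nat \<times> nat \<Rightarrow> real) \<Rightarrow> nat \<times> nat \<Rightarrow> real" where
  "sign_signal n t I \<epsilon> = (\<lambda>(i, j)\<in>{..<n} \<times> {..<n}.
     if i \<in> I \<or> j \<in> I then t * \<epsilon> (min i j, max i j) else 0)"

lemma finite_upper [simp]: "finite (upper n)"
  by (rule finite_subset[of _ "{..<n} \<times> {..<n}"]) (auto simp: upper_def)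

lemma signs_not_empty: "signs n \<noteq> {}"
  by (simp add: signs_def PiE_eq_empty_iff)

lemma card_signs: "card (signs n) = 2 ^ card (upper n)"
  by (simp add: signs_def card_PiE numeral_2_eq_2)

lemma signs_apply_cases: "\<epsilon> \<in> signs n \<Longrightarrow> i < n \<Longrightarrow> j < n \<Longrightarrow> \<epsilon> (min i j, max i j) \<in> {- 1, 1}"
  by (auto simp: signs_def upper_def PiE_iff)

lemma noise_law_eq: "noise_law n \<sigma> = (\<Pi>\<^sub>M q\<in>upper n. gauss \<sigma>)"
  by (simp add: noise_law_def upper_def gauss_def)

text \<open>Every row of the support is filled completely with \<open>t\<close> or
  \<open>- t\<close>. Its \<open>n > m\<close> nonzero entries identify the support through
  \<open>node_support_eqI\<close>, and at least \<open>n - m\<close> of them lie in columns outside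
  \<open>I\<close>, which gives the norm condition.\<close>

lemma sign_signal_in_class:
  assumes t: "0 < t" "b\<^sup>2 \<le> t\<^sup>2 * (real n - real m)" and m: "m < n"
    and I: "I \<subseteq> {..<n}" "card I \<le> m" and \<epsilon>: "\<epsilon> \<in> signs n"
  shows "node_support n (sign_signal n t I \<epsilon>) = I"
    and "sign_signal n t I \<epsilon> \<in> signal_class b n m"
proof -
  let ?B = "sign_signal n t I \<epsilon>"
  have sq: "(?B (i, j))\<^sup>2 = t\<^sup>2" if "i < n" "j < n" "i \<in> I \<or> j \<in> I" for i j
    using signs_apply_cases[OF \<epsilon> that(1,2)] that
    by (auto simp: sign_signal_def power_mult_distrib)
  then have nz: "?B (i, j) \<noteq> 0" if "i < n" "j < n" "i \<in> I \<or> j \<in> I" for i j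
    using that t by fastforce
  have zero: "?B (i, j) = 0" if "i \<in> {..<n} - I" "j \<in> {..<n} - I" for i j
    using that by (simp add: sign_signal_def)
  have l0: "m + 1 \<le> row_l0 n ?B i" if "i \<in> I" for i
  proof -
    have "{j \<in> {..<n}. ?B (i, j) \<noteq> 0} = {..<n}" using nz that I by auto
    then show ?thesis using m by (simp add: row_l0_def)
  qed
  have covers: "covers n ?B I"
    unfolding covers_def
  proof (intro conjI ballI I(1))
    fix i assume i: "i \<in> I"
    then have "i < n" using I by auto
    have "0 < \<bar>?B (i, i)\<bar>" using nz i \<open>i < n\<close> by auto
    also have "\<dots> \<le> L2_set (\<lambda>j. \<bar>?B (i, j)\<bar>) {..<n}"
      using \<open>i < n\<close> by (intro member_le_L2_set) auto
    also have "\<dots> = row_l2_on ?B i {..<n}"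
      by (simp add: row_l2_on_def L2_set_def)
    finally show "0 < row_l2_on ?B i {..<n}" .
  qed (fact zero)
  show supp: "node_support n ?B = I"
    by (rule node_support_eqI[OF covers I(2)]) (rule l0)
  have l2: "b \<le> row_l2_on ?B i (({..<n} - I) \<union> {i})" if "i \<in> I" for i
  proof -
    have i: "i < n" using that I by auto
    have "real n - real m \<le> card ({..<n} - I)"
      using I by (simp add: card_Diff_subset finite_subset)
    also have "\<dots> \<le> card (({..<n} - I) \<union> {i})"
      by (intro of_nat_mono card_mono) auto
    finally have "b\<^sup>2 \<le> t\<^sup>2 * card (({..<n} - I) \<union> {i})"
      using t by (smt (verit) mult_left_mono zero_le_power2)
    also have "\<dots> = (\<Sum>j\<in>({..<n} - I) \<union> {i}. (?B (i, j))\<^sup>2)"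
      using that i sq by (subst sum.cong[OF refl, of _ _ "\<lambda>_. t\<^sup>2"]) auto
    \<comment> \<open>The root is the absolute value of \<open>b\<close>, so negative
      \<open>b\<close> is covered too.\<close>
    finally have "sqrt (b\<^sup>2) \<le> row_l2_on ?B i (({..<n} - I) \<union> {i})"
      unfolding row_l2_on_def L2_set_def by (rule real_sqrt_le_mono)
    then show ?thesis by simp
  qed
  have "?B \<in> Sym n"
    by (auto simp: Sym_def matrix_space_def space_PiM sign_signal_def min.commute max.commute)
  then show "?B \<in> signal_class b n m"
    using I(2) l0 l2 zero by (simp add: signal_class_def supp)
qed

subsection \<open>Observations and risk\<close>

text \<open>Spreads the independent entries on and above the diagonal over a full symmetric
  matrix.\<close>

definition fold_noise :: "nat \<Rightarrow> (nat \<times> nat \<Rightarrow> real) \<Rightarrow> nat \<times> nat \<Rightarrow> real" where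
  "fold_noise n = observation n (\<lambda>_. 0)"

text \<open>A symmetric signal can be added to the independent entries before the matrix is filled
  by symmetry. It thus becomes a mean shift of a product Gaussian, as
  \<open>integral_PiM_gauss_shift\<close> requires.\<close>

lemma observation_sign_signal:
  "observation n (sign_signal n t I \<epsilon>) W
    = fold_noise n (\<lambda>q\<in>upper n. W q + (if touches I q then t * \<epsilon> q else 0))"
  by (auto simp: observation_def fold_noise_def sign_signal_def upper_def touches_def
      restrict_def fun_eq_iff min_def max_def)

lemma measurable_observation [measurable]:
  "observation n B \<in> noise_law n \<sigma> \<rightarrow>\<^sub>M matrix_space n"
  unfolding observation_def matrix_space_def
proof (rule measurable_restrict)
  fix p assume "p \<in> {..<n} \<times> {..<n}"
  then obtain i j where [simp]: "p = (i, j)" and ij: "i < n" "j < n" by auto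
  then have [measurable]: "(\<lambda>W. W (min i j, max i j)) \<in> borel_measurable (noise_law n \<sigma>)"
    unfolding noise_law_eq measurable_cong_sets[OF refl sets_gauss[of \<sigma>, symmetric]]
    by (intro measurable_component_singleton) (auto simp: upper_def)
  show "(\<lambda>W. case p of (i, j) \<Rightarrow> B (i, j) + W (min i j, max i j)) \<in> borel_measurable (noise_law n \<sigma>)"
    by simp
qed

lemma measurable_fold_noise [measurable]: "fold_noise n \<in> noise_law n \<sigma> \<rightarrow>\<^sub>M matrix_space n"
  unfolding fold_noise_def by measurable

lemma prob_space_observation_law: "0 < \<sigma> \<Longrightarrow> prob_space (observation_law n \<sigma> B)"
  unfolding observation_law_def noise_law_eq
  by (intro prob_space.prob_space_distr prob_space_PiM prob_space_gauss
      measurable_observation[unfolded noise_law_eq])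

lemma estimator_range:
  assumes "h \<in> estimators n" "Y \<in> space (matrix_space n)" "j < n"
  shows "h Y j \<in> {0..1}"
  using measurable_space[OF assms(1)[unfolded estimators_def] assms(2)] assms(3)
  by (auto simp: space_PiM space_restrict_space PiE_iff)

lemma measurable_estimator_component:
  assumes "h \<in> estimators n" "j < n"
  shows "(\<lambda>Y. h Y j) \<in> borel_measurable (matrix_space n)"
proof -
  have "(\<lambda>Y. h Y j) \<in> matrix_space n \<rightarrow>\<^sub>M restrict_space borel {0..1}"
    using measurable_compose[OF assms(1)[unfolded estimators_def]
        measurable_component_singleton[of j "{..<n}" "\<lambda>_. restrict_space borel {0..1}"]] assms(2)
    by simp
  then show ?thesis by (simp add: measurable_restrict_space2_iff)
qed

lemma support_indicator_range: "support_indicator n B j \<in> {0..1}"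
  by (simp add: support_indicator_def indicator_def)

lemma coordinate_loss_le_1:
  assumes "h \<in> estimators n" "Y \<in> space (matrix_space n)" "j < n"
  shows "\<bar>support_indicator n B j - h Y j\<bar> \<le> 1"
  using estimator_range[OF assms] support_indicator_range[of n B j] by (auto simp: abs_le_iff)

lemma integrable_coordinate_loss:
  assumes \<sigma>: "0 < \<sigma>" and h: "h \<in> estimators n" and j: "j < n"
  shows "integrable (observation_law n \<sigma> B) (\<lambda>Y. \<bar>support_indicator n B j - h Y j\<bar>)"
proof -
  interpret P: prob_space "observation_law n \<sigma> B" by (rule prob_space_observation_law[OF \<sigma>])
  show ?thesis
  proof (rule P.integrable_const_bound[where B=1])
    show "AE Y in observation_law n \<sigma> B. norm \<bar>support_indicator n B j - h Y j\<bar> \<le> 1"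
      using coordinate_loss_le_1[OF h _ j] by (intro AE_I2) (simp add: observation_law_def)
    show "(\<lambda>Y. \<bar>support_indicator n B j - h Y j\<bar>) \<in> borel_measurable (observation_law n \<sigma> B)"
      using measurable_estimator_component[OF h j] by (simp add: observation_law_def)
  qed
qed

lemma risk_eq_sum:
  assumes "0 < \<sigma>" "h \<in> estimators n"
  shows "risk n \<sigma> B h = (\<Sum>j<n. \<integral>Y. \<bar>support_indicator n B j - h Y j\<bar> \<partial>observation_law n \<sigma> B)"
  unfolding risk_def hamming_def using integrable_coordinate_loss[OF assms]
  by (intro Bochner_Integration.integral_sum) auto

lemma risk_bounds:
  assumes \<sigma>: "0 < \<sigma>" and h: "h \<in> estimators n"
  shows "0 \<le> risk n \<sigma> B h" "risk n \<sigma> B h \<le> n"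
proof -
  interpret P: prob_space "observation_law n \<sigma> B" by (rule prob_space_observation_law[OF \<sigma>])
  show "0 \<le> risk n \<sigma> B h"
    unfolding risk_def hamming_def by (intro Bochner_Integration.integral_nonneg sum_nonneg) auto
  have "(\<integral>Y. \<bar>support_indicator n B j - h Y j\<bar> \<partial>observation_law n \<sigma> B) \<le> 1" if "j < n" for j
    using coordinate_loss_le_1[OF h _ that] integrable_coordinate_loss[OF \<sigma> h that]
    by (intro P.integral_le_const AE_I2) (simp_all add: observation_law_def)
  then have "(\<Sum>j<n. \<integral>Y. \<bar>support_indicator n B j - h Y j\<bar> \<partial>observation_law n \<sigma> B) \<le> (\<Sum>j<n. 1)"
    by (intro sum_mono) auto
  then show "risk n \<sigma> B h \<le> n" by (simp add: risk_eq_sum[OF \<sigma> h])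
qed

subsection \<open>The sign mixture\<close>

text \<open>The density, relative to pure noise, of the independent entries of the observation when
  the signs are uniform and the support is \<open>I\<close>.\<close>

definition mixture_density :: "nat \<Rightarrow> real \<Rightarrow> real \<Rightarrow> nat set \<Rightarrow> (nat \<times> nat \<Rightarrow> real) \<Rightarrow> real" where
  "mixture_density n \<sigma> t I W = (\<Prod>q\<in>upper n. if touches I q then sign_lr \<sigma> t (W q) else 1)"

text \<open>The error at node \<open>j\<close> averaged over the sign mixture with support
  \<open>I\<close>, as an integral over pure noise.\<close>

definition coordinate_risk ::
  "nat \<Rightarrow> real \<Rightarrow> real \<Rightarrow> ((nat \<times> nat \<Rightarrow> real) \<Rightarrow> nat \<Rightarrow> real) \<Rightarrow> nat set \<Rightarrow> nat \<Rightarrow> real" where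
  "coordinate_risk n \<sigma> t h I j =
     (\<integral>W. mixture_density n \<sigma> t I W * \<bar>indicator I j - h (fold_noise n W) j\<bar> \<partial>noise_law n \<sigma>)"

text \<open>The signs are independent, so a sum over sign arrays of products is a product of
  two-term sums. Each entry, touched or not, gives a factor 2, and these cancel the number of sign
  arrays.\<close>

lemma average_signs_gauss_lr:
  "(\<Sum>\<epsilon>\<in>signs n. \<Prod>q\<in>upper n. gauss_lr \<sigma> (if touches I q then t * \<epsilon> q else 0) (W q)) / card (signs n)
    = mixture_density n \<sigma> t I W"
proof -
  have "(\<Sum>\<epsilon>\<in>signs n. \<Prod>q\<in>upper n. gauss_lr \<sigma> (if touches I q then t * \<epsilon> q else 0) (W q))
      = (\<Prod>q\<in>upper n. \<Sum>s\<in>{- 1, 1}. gauss_lr \<sigma> (if touches I q then t * s else 0) (W q))"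
    unfolding signs_def by (subst prod_sum_PiE) auto
  also have "\<dots> = (\<Prod>q\<in>upper n. 2 * (if touches I q then sign_lr \<sigma> t (W q) else 1))"
    by (intro prod.cong) (auto simp: sign_lr_def)
  also have "\<dots> = card (signs n) * mixture_density n \<sigma> t I W"
    by (simp add: prod.distrib card_signs mixture_density_def)
  finally show ?thesis
    by (simp add: card_signs)
qed

text \<open>All sign arrays share the support \<open>I\<close>, so after the change of measure the
  loss no longer depends on them and the average falls on the likelihood ratios alone.\<close>

lemma average_risk_sign_signal:
  assumes \<sigma>: "0 < \<sigma>" and h: "h \<in> estimators n"
    and supp: "\<And>\<epsilon>. \<epsilon> \<in> signs n \<Longrightarrow> node_support n (sign_signal n t I \<epsilon>) = I"
  shows "(\<Sum>\<epsilon>\<in>signs n. risk n \<sigma> (sign_signal n t I \<epsilon>) h) / card (signs n)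
    = (\<Sum>j<n. coordinate_risk n \<sigma> t h I j)"
proof -
  define L where "L \<epsilon> W = (\<Prod>q\<in>upper n. gauss_lr \<sigma> (if touches I q then t * \<epsilon> q else 0) (W q))" for \<epsilon> W
  define g where "g j W = \<bar>indicator I j - h (fold_noise n W) j\<bar>" for j W
  interpret G: prob_space "gauss \<sigma>" by (rule prob_space_gauss[OF \<sigma>])
  interpret PG: product_sigma_finite "\<lambda>_::nat \<times> nat. gauss \<sigma>" ..
  have g_meas [measurable]: "g j \<in> borel_measurable (noise_law n \<sigma>)" if "j < n" for j
    unfolding g_def
    using measurable_compose[OF measurable_fold_noise measurable_estimator_component[OF h that]]
    by measurable
  have g_le: "\<bar>g j W\<bar> \<le> 1" if "j < n" "W \<in> space (noise_law n \<sigma>)" for j W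
    using estimator_range[OF h measurable_space[OF measurable_fold_noise that(2)] that(1)]
    by (auto simp: g_def indicator_def abs_le_iff)
  have L_int: "integrable (noise_law n \<sigma>) (L \<epsilon>)" for \<epsilon>
    unfolding noise_law_eq L_def using has_bochner_integral_gauss_lr[OF \<sigma>]
    by (intro PG.product_integrable_prod) (auto simp: has_bochner_integral_iff)
  have Lg_int: "integrable (noise_law n \<sigma>) (\<lambda>W. L \<epsilon> W * g j W)" if "j < n" for \<epsilon> j
  proof (rule Bochner_Integration.integrable_bound[OF L_int[of \<epsilon>]])
    show "(\<lambda>W. L \<epsilon> W * g j W) \<in> borel_measurable (noise_law n \<sigma>)"
      using L_int[of \<epsilon>] g_meas[OF that] by measurable
    show "AE W in noise_law n \<sigma>. norm (L \<epsilon> W * g j W) \<le> norm (L \<epsilon> W)"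
      using g_le[OF that] by (intro AE_I2) (auto simp: abs_mult intro: mult_left_le)
  qed
  have coord: "(\<integral>Y. \<bar>support_indicator n (sign_signal n t I \<epsilon>) j - h Y j\<bar>
        \<partial>observation_law n \<sigma> (sign_signal n t I \<epsilon>)) = (\<integral>W. L \<epsilon> W * g j W \<partial>noise_law n \<sigma>)"
    if "\<epsilon> \<in> signs n" "j < n" for \<epsilon> j
  proof -
    have "(\<integral>Y. \<bar>support_indicator n (sign_signal n t I \<epsilon>) j - h Y j\<bar>
        \<partial>observation_law n \<sigma> (sign_signal n t I \<epsilon>))
      = (\<integral>W. g j (\<lambda>q\<in>upper n. W q + (if touches I q then t * \<epsilon> q else 0)) \<partial>noise_law n \<sigma>)"
      unfolding observation_law_def using measurable_estimator_component[OF h that(2)]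
      by (subst integral_distr)
        (auto simp: observation_sign_signal g_def support_indicator_def supp[OF that(1)])
    also have "\<dots> = (\<integral>W. L \<epsilon> W * g j W \<partial>noise_law n \<sigma>)"
      unfolding noise_law_eq L_def
      by (rule integral_PiM_gauss_shift[OF \<sigma> finite_upper g_meas[OF that(2), unfolded noise_law_eq]])
    finally show ?thesis .
  qed
  have "(\<Sum>\<epsilon>\<in>signs n. risk n \<sigma> (sign_signal n t I \<epsilon>) h)
      = (\<Sum>\<epsilon>\<in>signs n. \<Sum>j<n. \<integral>W. L \<epsilon> W * g j W \<partial>noise_law n \<sigma>)"
    by (intro sum.cong refl) (simp add: risk_eq_sum[OF \<sigma> h] coord)
  also have "\<dots> = (\<Sum>j<n. \<Sum>\<epsilon>\<in>signs n. \<integral>W. L \<epsilon> W * g j W \<partial>noise_law n \<sigma>)"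
    by (rule sum.swap)
  also have "\<dots> = (\<Sum>j<n. \<integral>W. (\<Sum>\<epsilon>\<in>signs n. L \<epsilon> W) * g j W \<partial>noise_law n \<sigma>)"
    unfolding sum_distrib_right
    by (intro sum.cong refl Bochner_Integration.integral_sum[symmetric] Lg_int) auto
  also have "\<dots> = (\<Sum>j<n. \<integral>W. card (signs n) * (mixture_density n \<sigma> t I W * g j W) \<partial>noise_law n \<sigma>)"
    by (simp add: average_signs_gauss_lr[symmetric] L_def card_signs)
  also have "\<dots> = (\<Sum>j<n. coordinate_risk n \<sigma> t h I j) * card (signs n)"
    by (simp add: coordinate_risk_def g_def sum_distrib_left mult.commute)
  finally show ?thesis by (simp add: card_signs)
qed

lemma coordinate_risk_nonneg: "0 \<le> coordinate_risk n \<sigma> t h I j"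
  unfolding coordinate_risk_def mixture_density_def
  by (intro Bochner_Integration.integral_nonneg mult_nonneg_nonneg prod_nonneg) auto

lemma coordinate_risk_pair:
  assumes \<sigma>: "0 < \<sigma>" and h: "h \<in> estimators n" and p: "0 \<le> p" "p < 1"
    and i: "i < n" "i \<notin> S"
  shows "p - p\<^sup>2 / (4 * (1 - p)) * exp (real n * t ^ 4 / (2 * \<sigma> ^ 4))
    \<le> p * coordinate_risk n \<sigma> t h (insert i S) i + (1 - p) * coordinate_risk n \<sigma> t h S i"
proof -
  define a where "a q w = (if touches S q then sign_lr \<sigma> t w else 1)" for q w
  \<comment> \<open>The entries with a nontrivial \<open>z\<close> are those that
    \<open>insert i S\<close> touches and \<open>S\<close> does not. Hence \<open>Z\<close> is the
    likelihood ratio between the two mixtures, and the factors \<open>a\<close> integrate to 1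
    independently of it.\<close>
  define z where "z q w = (if touches {i} q \<and> \<not> touches S q then sign_lr \<sigma> t w else 1)" for q w
  define Z where "Z W = (\<Prod>q\<in>upper n. z q (W q))" for W
  interpret G: prob_space "gauss \<sigma>" by (rule prob_space_gauss[OF \<sigma>])
  interpret PG: product_sigma_finite "\<lambda>_::nat \<times> nat. gauss \<sigma>" ..
  have one: "has_bochner_integral (gauss \<sigma>) (\<lambda>w. 1 :: real) 1"
    using has_bochner_integral_gauss_lr[OF \<sigma>, of 0] by (simp add: gauss_lr_def[abs_def])
  note M1 = has_bochner_integral_sign_lr[OF \<sigma>, of t]
  note M2 = has_bochner_integral_sign_lr_square[OF \<sigma>, of t]
  let ?c = "cosh (t\<^sup>2 / \<sigma>\<^sup>2)"
  have ia: "has_bochner_integral (gauss \<sigma>) (a q) 1" for q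
    using one M1 by (cases "touches S q") (simp_all add: a_def[abs_def])
  have iaz: "has_bochner_integral (gauss \<sigma>) (\<lambda>w. a q w * z q w) 1" for q
    using one M1 by (cases "touches S q"; cases "touches {i} q") (simp_all add: a_def z_def)
  have iazz: "has_bochner_integral (gauss \<sigma>) (\<lambda>w. a q w * (z q w)\<^sup>2)
      (if touches {i} q \<and> \<not> touches S q then ?c else 1)" for q
    using one M1 M2 by (cases "touches S q"; cases "touches {i} q") (simp_all add: a_def z_def)
  have D: "mixture_density n \<sigma> t S W = (\<Prod>q\<in>upper n. a q (W q))" for W
    by (simp add: mixture_density_def a_def)
  have DZ: "mixture_density n \<sigma> t S W * Z W = (\<Prod>q\<in>upper n. a q (W q) * z q (W q))" for W
    by (simp add: D Z_def prod.distrib)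
  have DZ': "mixture_density n \<sigma> t (insert i S) W = mixture_density n \<sigma> t S W * Z W" for W
    unfolding DZ unfolding mixture_density_def
    by (intro prod.cong) (auto simp: a_def z_def touches_def)
  have DZZ: "mixture_density n \<sigma> t S W * (Z W)\<^sup>2 = (\<Prod>q\<in>upper n. a q (W q) * (z q (W q))\<^sup>2)" for W
    by (simp add: D Z_def prod.distrib prod_power_distrib)
  have int: "integrable (noise_law n \<sigma>) (mixture_density n \<sigma> t S)"
    "integrable (noise_law n \<sigma>) (\<lambda>W. mixture_density n \<sigma> t S W * Z W)"
    "integrable (noise_law n \<sigma>) (\<lambda>W. mixture_density n \<sigma> t S W * (Z W)\<^sup>2)"
    unfolding DZ DZZ unfolding D[abs_def] noise_law_eq using ia iaz iazz
    by (auto intro!: PG.product_integrable_prod simp: has_bochner_integral_iff)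
  have mass: "(\<integral>W. mixture_density n \<sigma> t S W * Z W \<partial>noise_law n \<sigma>) = 1"
    unfolding DZ noise_law_eq using iaz
    by (subst PG.product_integral_prod) (auto simp: has_bochner_integral_iff)
  have chi: "(\<integral>W. mixture_density n \<sigma> t S W * (Z W)\<^sup>2 \<partial>noise_law n \<sigma>)
      \<le> exp (real n * t ^ 4 / (2 * \<sigma> ^ 4))"
  proof -
    let ?T = "{q\<in>upper n. touches {i} q \<and> \<not> touches S q}"
    have "(\<integral>W. mixture_density n \<sigma> t S W * (Z W)\<^sup>2 \<partial>noise_law n \<sigma>)
        = (\<Prod>q\<in>upper n. if touches {i} q \<and> \<not> touches S q then ?c else 1)"
      unfolding DZZ noise_law_eq using iazz
      by (subst PG.product_integral_prod) (auto simp: has_bochner_integral_iff)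
    also have "\<dots> = ?c ^ card ?T"
      by (subst prod.inter_filter[symmetric]) auto
    also have "\<dots> \<le> ?c ^ n"
    proof (rule power_increasing)
      \<comment> \<open>An entry in row or column \<open>i\<close> is determined by its other index,
        for which there are \<open>n\<close> choices.\<close>
      have "?T \<subseteq> (\<lambda>j. (min i j, max i j)) ` {..<n}"
      proof
        fix q assume "q \<in> ?T"
        then have q: "fst q \<le> snd q" "snd q < n" "fst q = i \<or> snd q = i"
          by (auto simp: upper_def touches_def)
        then have "q = (min i (if fst q = i then snd q else fst q), max i (if fst q = i then snd q else fst q))"
          by (cases q) auto
        then show "q \<in> (\<lambda>j. (min i j, max i j)) ` {..<n}"
          using q by (intro image_eqI[where x="if fst q = i then snd q else fst q"]) auto
      qed
      then have "card ?T \<le> card {..<n}" by (rule surj_card_le[rotated]) simp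
      then show "card ?T \<le> n" by simp
    qed (rule cosh_real_ge_1)
    also have "\<dots> \<le> exp ((t\<^sup>2 / \<sigma>\<^sup>2)\<^sup>2 / 2) ^ n"
      by (intro power_mono cosh_le_exp_half_square) auto
    also have "\<dots> = exp (real n * t ^ 4 / (2 * \<sigma> ^ 4))"
      by (simp add: exp_of_nat_mult[symmetric] power_divide power2_eq_square power4_eq_xxxx mult_ac)
    finally show ?thesis .
  qed
  have nonneg: "0 \<le> mixture_density n \<sigma> t S W" for W
    unfolding mixture_density_def by (intro prod_nonneg) auto
  have "(\<lambda>W. h (fold_noise n W) i) \<in> borel_measurable (noise_law n \<sigma>)"
    by (rule measurable_compose[OF measurable_fold_noise measurable_estimator_component[OF h i(1)]])
  from two_point_bayes_risk[OF p int nonneg mass chi this]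
  show ?thesis
    using estimator_range[OF h measurable_space[OF measurable_fold_noise] i(1)] i(2)
    by (simp add: coordinate_risk_def DZ')
qed

subsection \<open>The lower bound\<close>

text \<open>The supremum dominates the risk averaged over signs and over supports of size at most
  \<open>m\<close>. Each of the \<open>n\<close> nodes contributes at least \<open>p * c\<close>
  times the probability of \<open>card S < m\<close>, and \<open>n * p = m'\<close>.\<close>

lemma bayes_lower_bound:
  assumes \<sigma>: "0 < \<sigma>" and h: "h \<in> estimators n" and m: "m < n"
    and t: "0 < t" "b\<^sup>2 \<le> t\<^sup>2 * (real n - real m)"
    and m': "0 < m'" "m' \<le> real m"
  defines "c \<equiv> 1 - (m' / n) / (4 * (1 - m' / n)) * exp (real n * t ^ 4 / (2 * \<sigma> ^ 4))"
  shows "m' * (c - exp (- ((real m - m')\<^sup>2 / (2 * real m))))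
    \<le> (SUP B\<in>signal_class b n m. risk n \<sigma> B h)"
proof -
  define p where "p = m' / real n"
  define s where "s = (SUP B\<in>signal_class b n m. risk n \<sigma> B h)"
  define e where "e = exp (- ((real m - m')\<^sup>2 / (2 * real m)))"
  let ?N = "{..<n}" and ?w = "bernoulli_weight p"
  have m'n: "m' < n" using m m' by simp
  have p: "0 < p" "p < 1" "p * n = m'" using m' m'n by (auto simp: p_def)
  \<comment> \<open>\<open>c\<close> may be negative; this upper bound is what shows that discarding
    the tail costs at most the tail probability.\<close>
  have c: "c \<le> 1" using p by (simp add: c_def p_def[symmetric])
  have pc: "p * c = p - p\<^sup>2 / (4 * (1 - p)) * exp (real n * t ^ 4 / (2 * \<sigma> ^ 4))"
    by (simp add: c_def p_def[symmetric] power2_eq_square algebra_simps)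
  have risk_le: "risk n \<sigma> B h \<le> s" if "B \<in> signal_class b n m" for B
    unfolding s_def using risk_bounds(2)[OF \<sigma> h] that
    by (intro cSUP_upper bdd_aboveI2) auto
  \<comment> \<open>Nonnegativity later allows adding the missing weight of supports larger than
    \<open>m\<close>. Empty support supplies a member of the class.\<close>
  have s_nonneg: "0 \<le> s"
  proof -
    obtain \<epsilon> where "\<epsilon> \<in> signs n" using signs_not_empty by auto
    then have "sign_signal n t {} \<epsilon> \<in> signal_class b n m"
      using t m by (intro sign_signal_in_class) auto
    from risk_le[OF this] risk_bounds(1)[OF \<sigma> h] show ?thesis by (rule order_trans[rotated])
  qed
  have "m' * (c - e) \<le> (\<Sum>i\<in>?N. p * c * (\<Sum>S\<in>{S\<in>Pow (?N - {i}). card S < m}. ?w (?N - {i}) S))"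
  proof -
    have "p * (c - e) \<le> p * c * (\<Sum>S\<in>{S\<in>Pow (?N - {i}). card S < m}. ?w (?N - {i}) S)"
      if i: "i \<in> ?N" for i
    proof -
      let ?A = "?N - {i}"
      let ?tail = "\<Sum>S\<in>{S\<in>Pow ?A. m \<le> card S}. ?w ?A S"
      have "?tail \<le> e"
        unfolding p_def e_def using m' m'n
        by (intro bernoulli_tail) (auto intro: order_trans[OF card_Diff1_le])
      moreover have "0 \<le> ?tail"
        using p by (intro sum_nonneg bernoulli_weight_nonneg) auto
      moreover have "(\<Sum>S\<in>{S\<in>Pow ?A. card S < m}. ?w ?A S) + ?tail = (\<Sum>S\<in>Pow ?A. ?w ?A S)"
        by (subst sum.union_disjoint[symmetric]) (auto intro!: sum.cong)
      moreover have "(\<Sum>S\<in>Pow ?A. ?w ?A S) = 1"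
        using sum_bernoulli_weight_power[of ?A p 1] by simp
      ultimately have sum: "(\<Sum>S\<in>{S\<in>Pow ?A. card S < m}. ?w ?A S) = 1 - ?tail"
        and tail: "?tail \<le> e" "0 \<le> ?tail" by linarith+
      have "c * ?tail \<le> 1 * ?tail" using c tail by (intro mult_right_mono) auto
      then have "c - e \<le> c * (1 - ?tail)" using tail by (simp add: algebra_simps)
      then have "p * (c - e) \<le> p * (c * (1 - ?tail))" using p by (intro mult_left_mono) auto
      then show ?thesis by (simp only: sum mult.assoc)
    qed
    then have "(\<Sum>i\<in>?N. p * (c - e)) \<le> (\<Sum>i\<in>?N. p * c * (\<Sum>S\<in>{S\<in>Pow (?N - {i}). card S < m}. ?w (?N - {i}) S))"
      by (rule sum_mono)
    then show ?thesis by (simp add: p(3)[symmetric] mult_ac)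
  qed
  also have "\<dots> = (\<Sum>i\<in>?N. \<Sum>S\<in>{S\<in>Pow (?N - {i}). card S < m}. ?w (?N - {i}) S * (p * c))"
    by (simp add: sum_distrib_left mult_ac)
  also have "\<dots> \<le> (\<Sum>i\<in>?N. \<Sum>S\<in>{S\<in>Pow (?N - {i}). card S < m}. ?w (?N - {i}) S *
      (p * coordinate_risk n \<sigma> t h (insert i S) i + (1 - p) * coordinate_risk n \<sigma> t h S i))"
    unfolding pc using p
    by (intro sum_mono mult_left_mono coordinate_risk_pair \<sigma> h bernoulli_weight_nonneg) auto
  also have "\<dots> \<le> (\<Sum>I\<in>{I\<in>Pow ?N. card I \<le> m}. ?w ?N I * (\<Sum>i\<in>?N. coordinate_risk n \<sigma> t h I i))"
    using p by (intro bernoulli_average_pairs coordinate_risk_nonneg) auto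
  also have "\<dots> \<le> (\<Sum>I\<in>{I\<in>Pow ?N. card I \<le> m}. ?w ?N I * s)"
  proof (intro sum_mono mult_left_mono)
    fix I assume I: "I \<in> {I\<in>Pow ?N. card I \<le> m}"
    then have cls: "node_support n (sign_signal n t I \<epsilon>) = I"
        "sign_signal n t I \<epsilon> \<in> signal_class b n m" if "\<epsilon> \<in> signs n" for \<epsilon>
      using sign_signal_in_class[OF t m _ _ that] by auto
    have "(\<Sum>i\<in>?N. coordinate_risk n \<sigma> t h I i)
        = (\<Sum>\<epsilon>\<in>signs n. risk n \<sigma> (sign_signal n t I \<epsilon>) h) / card (signs n)"
      by (rule average_risk_sign_signal[OF \<sigma> h cls(1), symmetric])
    also have "\<dots> \<le> (\<Sum>\<epsilon>\<in>signs n. s) / card (signs n)"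
      by (intro divide_right_mono sum_mono risk_le cls(2)) auto
    also have "\<dots> = s" by (simp add: card_signs)
    finally show "(\<Sum>i\<in>?N. coordinate_risk n \<sigma> t h I i) \<le> s" .
  qed (use p in \<open>auto intro: bernoulli_weight_nonneg\<close>)
  also have "\<dots> \<le> (\<Sum>I\<in>Pow ?N. ?w ?N I * s)"
    using p s_nonneg by (intro sum_mono2) (auto intro!: mult_nonneg_nonneg bernoulli_weight_nonneg)
  also have "\<dots> = s"
    using sum_bernoulli_weight_power[of ?N p 1] by (simp add: sum_distrib_right[symmetric])
  finally show ?thesis unfolding s_def e_def .
qed

text \<open>The constant 9/2 is chosen so that the last exponential of \<open>f_bound\<close> is the
  square of \<open>x\<close>, while the second-moment bound is at most \<open>2 * x\<close>. A
  quadratic inequality in \<open>x\<close> then compares the two.\<close>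

lemma f_bound_le:
  assumes p: "0 < m'" "m' < real n / 3" and n: "2 \<le> n" and \<sigma>: "0 < \<sigma>"
    and t: "t\<^sup>2 = (3 * b\<^sup>2 / 2 + \<sigma>\<^sup>2) / n"
  shows "f_bound 1 n (9 / 2 * b ^ 4 / \<sigma> ^ 4) m' / 4
    \<le> 1 - (m' / n) / (4 * (1 - m' / n)) * exp (real n * t ^ 4 / (2 * \<sigma> ^ 4))"
proof -
  define q where "q = m' / real n"
  define x where "x = exp (9 / 4 * (b ^ 4 / \<sigma> ^ 4) / n)"
  define \<beta> where "\<beta> = b\<^sup>2 / \<sigma>\<^sup>2"
  have q: "0 < q" "q < 1 / 3" using p n by (auto simp: q_def field_simps)
  have \<beta>2: "b ^ 4 / \<sigma> ^ 4 = \<beta>\<^sup>2"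
    by (simp add: \<beta>_def power_divide power_mult[symmetric])
  have u: "real n * t\<^sup>2 / \<sigma>\<^sup>2 = 3 * \<beta> / 2 + 1"
    using n \<sigma> by (simp add: t \<beta>_def field_simps)
  have "real n * t ^ 4 / (2 * \<sigma> ^ 4) = (real n * t\<^sup>2 / \<sigma>\<^sup>2)\<^sup>2 / (2 * real n)"
    using n \<sigma> by (simp add: power2_eq_square power4_eq_xxxx field_simps)
  also have "\<dots> = (3 * \<beta> / 2 + 1)\<^sup>2 / (2 * real n)"
    by (simp only: u)
  \<comment> \<open>The inequality \<open>(u + 1)\<^sup>2 \<le> 2 * (u\<^sup>2 + 1)\<close> at
    \<open>u = 3 * \<beta> / 2\<close> separates the signal from the extra
    \<open>\<sigma>\<^sup>2\<close> in \<open>t\<^sup>2\<close>, whose share \<open>1 / n\<close>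
    costs at most a factor 2.\<close>
  also have "\<dots> \<le> 2 * (9 / 4 * \<beta>\<^sup>2 + 1) / (2 * real n)"
    using zero_le_power2[of "3 * \<beta> / 2 - 1"]
    by (intro divide_right_mono) (simp_all add: power2_eq_square algebra_simps)
  also have "\<dots> = 9 / 4 * (b ^ 4 / \<sigma> ^ 4) / n + 1 / n"
    unfolding \<beta>2 using n by (simp add: add_divide_distrib)
  also have "\<dots> \<le> 9 / 4 * (b ^ 4 / \<sigma> ^ 4) / n + 1 / 2"
    using n by simp
  finally have "exp (real n * t ^ 4 / (2 * \<sigma> ^ 4)) \<le> exp (9 / 4 * (b ^ 4 / \<sigma> ^ 4) / n + 1 / 2)"
    by simp
  also have "\<dots> = x * exp (1 / 2)" by (simp only: exp_add x_def)
  also have "\<dots> \<le> x * 2"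
    using exp_half_le2 by (intro mult_left_mono) (auto simp: x_def)
  finally have X: "exp (real n * t ^ 4 / (2 * \<sigma> ^ 4)) \<le> 2 * x" by simp
  have x2: "exp (1 * (9 / 2 * b ^ 4 / \<sigma> ^ 4) / n) = x\<^sup>2"
    by (simp add: x_def exp_double[symmetric])
  have "f_bound 1 n (9 / 2 * b ^ 4 / \<sigma> ^ 4) m' \<le> 3 - q * x\<^sup>2"
    unfolding f_bound_def x2 q_def[symmetric] using q by (simp add: algebra_simps add_nonneg_nonneg)
  \<comment> \<open>This amounts to \<open>q * (3 * x - x\<^sup>2) \<le> 1\<close>; the left side is
    at most 3/4, as the parabola peaks at 9/4 and \<open>q < 1 / 3\<close>.\<close>
  also have "\<dots> \<le> 4 * (1 - 3 / 8 * q * (2 * x))"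
  proof -
    have "3 * x - x\<^sup>2 \<le> 9 / 4"
      using zero_le_power2[of "x - 3 / 2"] by (simp add: power2_eq_square algebra_simps)
    then have "q * (3 * x - x\<^sup>2) \<le> q * (9 / 4)" using q by (intro mult_left_mono) auto
    then show ?thesis using q by (simp add: algebra_simps)
  qed
  finally have "f_bound 1 n (9 / 2 * b ^ 4 / \<sigma> ^ 4) m' / 4 \<le> 1 - 3 / 8 * q * (2 * x)" by simp
  also have "\<dots> \<le> 1 - 3 / 8 * q * exp (real n * t ^ 4 / (2 * \<sigma> ^ 4))"
    using X q by (simp add: mult_left_mono)
  also have "\<dots> \<le> 1 - q / (4 * (1 - q)) * exp (real n * t ^ 4 / (2 * \<sigma> ^ 4))"
  proof -
    \<comment> \<open>From \<open>q < 1 / 3\<close>, the factor \<open>1 / (1 - q)\<close> is below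
      3/2.\<close>
    have "q / (4 * (1 - q)) \<le> 3 / 8 * q"
      using q mult_left_mono[of "q * 3" 1 q] by (simp add: field_simps)
    then have "q / (4 * (1 - q)) * exp (real n * t ^ 4 / (2 * \<sigma> ^ 4))
        \<le> 3 / 8 * q * exp (real n * t ^ 4 / (2 * \<sigma> ^ 4))"
      by (rule mult_right_mono) simp
    then show ?thesis by linarith
  qed
  finally show ?thesis unfolding q_def .
qed

theorem theorem5:
  shows "\<exists>C>0. \<exists>C'>0. \<forall>\<^sub>F n in sequentially.
    \<forall>(m::nat) (b::real) (\<sigma>::real). 0 < m \<longrightarrow> real m < real n / 3 \<longrightarrow> 0 < \<sigma> \<longrightarrow>
      (INF h\<in>estimators n. SUP B\<in>signal_class b n m. risk n \<sigma> B h)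
      \<ge> (SUP m'\<in>{0<..real m}.
            4 * m' * (1 / 16 * f_bound C' n (C * b ^ 4 / \<sigma> ^ 4) m'
                      - exp (- ((real m - m')\<^sup>2 / (2 * real m)))))"
proof (rule exI[of _ "9 / 2"], rule conjI, simp, rule exI[of _ 1], rule conjI, simp,
    rule eventually_sequentiallyI[of 2], intro allI impI)
  fix n m :: nat and b \<sigma> :: real
  assume n: "2 \<le> n" and m: "0 < m" "real m < real n / 3" and \<sigma>: "0 < \<sigma>"
  define t where "t = sqrt ((3 * b\<^sup>2 / 2 + \<sigma>\<^sup>2) / n)"
  have t2: "t\<^sup>2 = (3 * b\<^sup>2 / 2 + \<sigma>\<^sup>2) / n" and t_pos: "0 < t"
    using n \<sigma> by (auto simp: t_def intro!: divide_pos_pos add_nonneg_pos)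
  have mn: "m < n" using m by simp
  have tb: "b\<^sup>2 \<le> t\<^sup>2 * (real n - real m)"
  proof -
    \<comment> \<open>The factor 3/2 in \<open>t\<^sup>2\<close> compensates for
      \<open>n - m\<close> exceeding only two thirds of \<open>n\<close>.\<close>
    have "b\<^sup>2 \<le> (3 * b\<^sup>2 / 2 + \<sigma>\<^sup>2) / n * (2 / 3 * n)" using n by (simp add: field_simps)
    also have "\<dots> \<le> t\<^sup>2 * (real n - real m)"
      unfolding t2[symmetric] using m by (intro mult_left_mono) auto
    finally show ?thesis .
  qed
  have "(\<lambda>_. \<lambda>j\<in>{..<n}. 0) \<in> estimators n"
    unfolding estimators_def by (intro measurable_restrict measurable_const) (auto simp: space_restrict_space)
  then have ne: "estimators n \<noteq> {}" by auto
  show "(SUP m'\<in>{0<..real m}. 4 * m' * (1 / 16 * f_bound 1 n (9 / 2 * b ^ 4 / \<sigma> ^ 4) m'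
          - exp (- ((real m - m')\<^sup>2 / (2 * real m)))))
    \<le> (INF h\<in>estimators n. SUP B\<in>signal_class b n m. risk n \<sigma> B h)"
  proof (intro cSUP_least cINF_greatest ne)
    fix m' h assume m': "m' \<in> {0<..real m}" and h: "h \<in> estimators n"
    let ?e = "exp (- ((real m - m')\<^sup>2 / (2 * real m)))"
    let ?f = "f_bound 1 n (9 / 2 * b ^ 4 / \<sigma> ^ 4) m'"
    let ?c = "1 - (m' / n) / (4 * (1 - m' / n)) * exp (real n * t ^ 4 / (2 * \<sigma> ^ 4))"
    have "?f / 4 \<le> ?c"
      using m m' by (intro f_bound_le n \<sigma> t2) auto
    \<comment> \<open>The claimed bound is \<open>m' * (?f / 4 - 4 * ?e)\<close>, whereas the Bayes
      bound loses only one \<open>?e\<close>.\<close>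
    then have "?f / 4 - 4 * ?e \<le> ?c - ?e"
      using exp_ge_zero[of "- ((real m - m')\<^sup>2 / (2 * real m))"] by linarith
    then have "m' * (?f / 4 - 4 * ?e) \<le> m' * (?c - ?e)"
      using m' by (intro mult_left_mono) auto
    also have "\<dots> \<le> (SUP B\<in>signal_class b n m. risk n \<sigma> B h)"
      using m' by (intro bayes_lower_bound \<sigma> h mn t_pos tb) auto
    finally show "4 * m' * (1 / 16 * ?f - ?e) \<le> (SUP B\<in>signal_class b n m. risk n \<sigma> B h)"
      by (simp add: algebra_simps)
  qed (use m in auto)
qed

end
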